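(* Let $S\subseteq\mathbb{N}^p$ be a $\mathcal{C}$-semigroup, let $\tau_1,\ldots,\tau_t$ be the extremal rays of $\mathcal{C}_S$, and let $T$ be an $I(S)$-semigroup. Then $T$ is a $\mathcal{C}$-semigroup if and only if there exists $Y\subset T\setminus\{0\}$ such that $Y\cap\tau_i\neq\emptyset$ for all $i\in\{1,\ldots,t\}$.
   Context: $\mathbb{N}$ contains $0$, and $p\ge 1$. An affine semigroup $S\subseteq\mathbb{N}^p$ is a finitely generated submonoid of $(\mathbb{N}^p,+)$ (containing $0$). An ideal of $S$ is a non-empty subset $P\subseteq S$ with $P+S\subseteq P$. An affine semigroup $T$ is an $I(S)$-semigroup if $T\setminus\{0\}$ is an ideal of $S$. For $B\subseteq\mathbb{N}^p$, $\mathcal{C}_B=\{\sum_{i=1}^k\lambda_i b_i\mid k\in\mathbb{N},\ \lambda_i\in\mathbb{Q}_{\ge 0},\ b_i\in B\}\cap\mathbb{N}^p$ is the non-negative integer cone generated by $B$. A set $T\subseteq\mathbb{N}^p$ is called a $\mathcal{C}$-semigroup if $T$ is an affine semigroup and $\mathcal{C}_T\setminus T$ is finite. The extremal rays of $\mathcal{C}_S$ are the one-dimensional faces of the rational cone generated by $S$ (intersected with $\mathbb{N}^p$). *)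

theory Defs
  imports "HOL-Analysis.Analysis"
begin

definition add_submonoid :: "'a::comm_monoid_add set \<Rightarrow> bool" where
  "add_submonoid M \<longleftrightarrow> 0 \<in> M \<and> (\<forall>x\<in>M. \<forall>y\<in>M. x + y \<in> M)"

definition affine_semigroup :: "(nat ^ 'p) set \<Rightarrow> bool" where
  "affine_semigroup S \<longleftrightarrow>
     add_submonoid S \<and> (\<exists>A. finite A \<and> S = add_submonoid hull A)"

definition semigroup_ideal :: "(nat ^ 'p) set \<Rightarrow> (nat ^ 'p) set \<Rightarrow> bool" where
  "semigroup_ideal S P \<longleftrightarrow> P \<noteq> {} \<and> P \<subseteq> S \<and> (\<forall>x\<in>P. \<forall>s\<in>S. x + s \<in> P)"

definition I_semigroup :: "(nat ^ 'p) set \<Rightarrow> (nat ^ 'p) set \<Rightarrow> bool" where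
  "I_semigroup S T \<longleftrightarrow> affine_semigroup T \<and> semigroup_ideal S (T - {0})"

definition rat_vec :: "nat ^ 'p \<Rightarrow> rat ^ 'p" where
  "rat_vec x = (\<chi> i. of_nat (x $ i))"

definition rat_cone :: "(nat ^ 'p) set \<Rightarrow> (rat ^ 'p) set" where
  "rat_cone B = {(\<Sum>i<k. c i *s rat_vec (b i)) | (k::nat) c b.
     \<forall>i<k. 0 \<le> c i \<and> b i \<in> B}"

definition int_cone :: "(nat ^ 'p) set \<Rightarrow> (nat ^ 'p) set" where
  "int_cone B = {x. rat_vec x \<in> rat_cone B}"

definition C_semigroup :: "(nat ^ 'p) set \<Rightarrow> bool" where
  "C_semigroup T \<longleftrightarrow> affine_semigroup T \<and> finite (int_cone T - T)"

(* The library's convex and face_of exist only over the reals; these are the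
   same definitions with rational coefficients. *)

definition rat_convex :: "(rat ^ 'p) set \<Rightarrow> bool" where
  "rat_convex F \<longleftrightarrow>
     (\<forall>x\<in>F. \<forall>y\<in>F. \<forall>u. 0 \<le> u \<and> u \<le> 1 \<longrightarrow> (1 - u) *s x + u *s y \<in> F)"

definition rat_face_of :: "(rat ^ 'p) set \<Rightarrow> (rat ^ 'p) set \<Rightarrow> bool" where
  "rat_face_of F K \<longleftrightarrow> F \<subseteq> K \<and> rat_convex F \<and>
     (\<forall>a\<in>K. \<forall>b\<in>K. \<forall>u. 0 < u \<and> u < 1 \<and> (1 - u) *s a + u *s b \<in> F
        \<longrightarrow> a \<in> F \<and> b \<in> F)"

(* A non-empty face of a cone contains 0, so its dimension is that of its linear
   span over the rationals. *)

definition extremal_rays :: "(nat ^ 'p) set \<Rightarrow> (nat ^ 'p) set set" where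
  "extremal_rays S =
     {{x. rat_vec x \<in> F} | F. rat_face_of F (rat_cone S) \<and> vec.dim F = 1}"

end

theory Submission
  imports Defs
begin

text \<open>
  Both sides of the equivalence hold for every \<open>I(S)\<close>-semigroup \<open>T\<close>. Fix a non-zero \<open>t\<close> in \<open>T\<close> and
  let \<open>s\<close> be in \<open>S\<close>. All \<open>t + n s\<close> lie in \<open>T\<close>; writing them in terms of the finitely many generators
  of \<open>T\<close>, Dickson's lemma gives \<open>i < j\<close> such that the coefficients of \<open>t + i s\<close> are dominated by those
  of \<open>t + j s\<close>, and subtracting shows that \<open>(j - i) s\<close> lies in \<open>T\<close>. So every element of \<open>S\<close> has a
  positive multiple in \<open>T\<close>. Applied to the generators of \<open>S\<close>, together with the ideal property, this
  bounds the coefficients of the elements of \<open>S - T\<close>, which is therefore finite. Applied to a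
  non-zero element of \<open>S\<close> on an extremal ray, it gives a non-zero element of \<open>T\<close> on that ray.
\<close>

section \<open>Dickson's lemma\<close>

text \<open>Every sequence has a monotone subsequence. A decreasing one in the naturals is constant
  from an index of its least value on, so its tail is also weakly increasing.\<close>

lemma nat_seq_mono_subseq:
  fixes g :: "nat \<Rightarrow> nat"
  obtains r :: "nat \<Rightarrow> nat" where "strict_mono r" "mono (g \<circ> r)"
proof -
  obtain f :: "nat \<Rightarrow> nat" where f: "strict_mono f" "monoseq (\<lambda>n. g (f n))"
    using seq_monosub[of g] by blast
  show thesis
  proof (cases "incseq (\<lambda>n. g (f n))")
    case True
    then show thesis using that[of f] f by (simp add: comp_def)
  next
    case False
    with f have dec: "decseq (\<lambda>n. g (f n))" by (simp add: monoseq_iff)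
    obtain m where m: "\<And>n. g (f m) \<le> g (f n)"
      using ex_has_least_nat[of "\<lambda>_. True" _ "\<lambda>n. g (f n)"] by blast
    have const: "g (f (m + n)) = g (f m)" for n
      using m[of "m + n"] decseqD[OF dec, of m "m + n"] by simp
    have "strict_mono (\<lambda>n. f (m + n))"
      using f(1) by (simp add: strict_mono_def)
    moreover have "mono (g \<circ> (\<lambda>n. f (m + n)))"
      by (simp add: const mono_def)
    ultimately show thesis by (rule that)
  qed
qed

text \<open>Dickson's lemma for vectors indexed by \<open>A\<close>: coordinates are treated one at
  a time, and passing to a further subsequence keeps the earlier ones monotone.\<close>

lemma dickson_subseq:
  fixes g :: "nat \<Rightarrow> 'a \<Rightarrow> nat"
  assumes "finite A"
  shows "\<exists>r::nat \<Rightarrow> nat. strict_mono r \<and> (\<forall>a\<in>A. mono (\<lambda>n. g (r n) a))"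
  using assms
proof (induction A rule: finite_induct)
  case empty
  then show ?case by (intro exI[of _ id]) (simp add: strict_mono_def)
next
  case (insert x A)
  then obtain r :: "nat \<Rightarrow> nat" where r: "strict_mono r" "\<forall>a\<in>A. mono (\<lambda>n. g (r n) a)" by blast
  obtain q :: "nat \<Rightarrow> nat" where q: "strict_mono q" "mono ((\<lambda>n. g (r n) x) \<circ> q)"
    using nat_seq_mono_subseq .
  have "strict_mono (r \<circ> q)" by (rule strict_mono_o[OF r(1) q(1)])
  moreover have "mono (\<lambda>n. g ((r \<circ> q) n) a)" if "a \<in> insert x A" for a
  proof (cases "a = x")
    case True
    then show ?thesis using q(2) by (simp add: comp_def)
  next
    case False
    then have "mono (\<lambda>n. g (r n) a)" using that r(2) by simp
    then show ?thesis using strict_mono_mono[OF q(1)] by (simp add: mono_def)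
  qed
  ultimately show ?case by blast
qed

section \<open>Finitely generated submonoids\<close>

lemma add_submonoid_sum:
  assumes "add_submonoid M" "\<And>i. i \<in> I \<Longrightarrow> f i \<in> M"
  shows "sum f I \<in> M"
  using assms(2)
  by (induction I rule: infinite_finite_induct) (use assms(1) in \<open>auto simp: add_submonoid_def\<close>)

lemma add_submonoid_smult:
  fixes x :: "nat ^ 'p"
  assumes "add_submonoid M" "x \<in> M"
  shows "n *s x \<in> M"
proof -
  have "n *s x = (\<Sum>i<n. x)" by (simp add: vec_eq_iff of_nat_index)
  then show ?thesis using add_submonoid_sum[OF assms(1), of "{..<n}" "\<lambda>_. x"] assms(2) by simp
qed

text \<open>The combinations form a submonoid containing \<open>A\<close>, so minimality of the hull
  applies.\<close>

lemma add_submonoid_hull_combination: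
  fixes A :: "(nat ^ 'p) set"
  assumes "x \<in> add_submonoid hull A" "finite A"
  obtains m where "x = (\<Sum>a\<in>A. m a *s a)"
proof -
  let ?C = "{(\<Sum>a\<in>A. m a *s a) | m. True}"
  have "A \<subseteq> ?C"
  proof
    fix b assume "b \<in> A"
    have "(\<Sum>a\<in>A. (if a = b then 1 else 0) *s a) = (\<Sum>a\<in>A. if a = b then a else 0)"
      by (intro sum.cong) (auto simp del: One_nat_def)
    also have "\<dots> = b" using \<open>b \<in> A\<close> assms(2) by simp
    finally have "b = (\<Sum>a\<in>A. (if a = b then 1 else 0) *s a)" by (rule sym)
    then show "b \<in> ?C" by (intro CollectI exI[of _ "\<lambda>a. if a = b then 1 else 0"]) simp
  qed
  moreover have "add_submonoid ?C"
    unfolding add_submonoid_def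
  proof (intro conjI ballI)
    show "0 \<in> ?C" by (intro CollectI exI[of _ "\<lambda>_. 0"]) simp
  next
    fix x y assume "x \<in> ?C" "y \<in> ?C"
    then obtain m n where "x = (\<Sum>a\<in>A. m a *s a)" "y = (\<Sum>a\<in>A. n a *s a)" by blast
    then have "x + y = (\<Sum>a\<in>A. (m a + n a) *s a)"
      by (simp add: sum.distrib vector_sadd_rdistrib)
    then show "x + y \<in> ?C" by (intro CollectI exI[of _ "\<lambda>a. m a + n a"]) simp
  qed
  ultimately have "add_submonoid hull A \<subseteq> ?C" by (rule hull_minimal)
  then show thesis using assms(1) that by blast
qed

lemma affine_semigroup_add_submonoid: "affine_semigroup S \<Longrightarrow> add_submonoid S"
  by (simp add: affine_semigroup_def)

lemma affine_semigroup_generators: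
  assumes "affine_semigroup S"
  obtains A where "finite A" "A \<subseteq> S" "\<And>x. x \<in> S \<Longrightarrow> \<exists>m. x = (\<Sum>a\<in>A. m a *s a)"
proof -
  obtain A where A: "finite A" "S = add_submonoid hull A"
    using assms by (auto simp: affine_semigroup_def)
  show thesis
  proof
    show "finite A" "A \<subseteq> S" using A by (simp_all add: hull_subset)
    fix x assume "x \<in> S"
    then show "\<exists>m. x = (\<Sum>a\<in>A. m a *s a)"
      using add_submonoid_hull_combination[of x A] A by blast
  qed
qed

section \<open>Ideals of affine semigroups\<close>

lemma I_semigroup_subset: "I_semigroup S T \<Longrightarrow> add_submonoid S \<Longrightarrow> T \<subseteq> S"
  by (auto simp: I_semigroup_def semigroup_ideal_def add_submonoid_def)

lemma I_semigroup_add: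
  assumes "I_semigroup S T" "t \<in> T" "t \<noteq> 0" "s \<in> S"
  shows "t + s \<in> T"
  using assms by (auto simp: I_semigroup_def semigroup_ideal_def)

lemma I_semigroup_multiple:
  assumes S: "add_submonoid S" and T: "I_semigroup S T" and s: "s \<in> S"
  shows "\<exists>k>0. k *s s \<in> T"
proof -
  have aff: "affine_semigroup T" using T by (simp add: I_semigroup_def)
  then obtain A where A: "finite A" "A \<subseteq> T" "\<And>x. x \<in> T \<Longrightarrow> \<exists>m. x = (\<Sum>a\<in>A. m a *s a)"
    using affine_semigroup_generators by blast
  obtain t where t: "t \<in> T" "t \<noteq> 0"
    using T by (auto simp: I_semigroup_def semigroup_ideal_def)
  \<comment> \<open>The shift by \<open>t\<close> moves all multiples of \<open>s\<close> into the
    ideal; it cancels at the end.\<close>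
  have "t + n *s s \<in> T" for n
    by (rule I_semigroup_add[OF T t add_submonoid_smult[OF S s]])
  then have "\<forall>n. \<exists>m. t + n *s s = (\<Sum>a\<in>A. m a *s a)" using A(3) by blast
  then obtain m where m: "\<And>n. t + n *s s = (\<Sum>a\<in>A. m n a *s a)" by metis
  obtain r :: "nat \<Rightarrow> nat" where r: "strict_mono r" "\<forall>a\<in>A. mono (\<lambda>n. m (r n) a)"
    using dickson_subseq[OF A(1)] by blast
  define i j where "i = r 0" and "j = r 1"
  have "i < j" using r(1) by (simp add: i_def j_def strict_mono_def)
  have le: "m i a \<le> m j a" if "a \<in> A" for a
    using r(2) that by (auto simp: i_def j_def mono_def)
  let ?d = "\<Sum>a\<in>A. (m j a - m i a) *s a"
  have "(t + i *s s) + (j - i) *s s = t + j *s s"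
    using \<open>i < j\<close> by (simp add: add.assoc vector_sadd_rdistrib[symmetric])
  also have "\<dots> = (\<Sum>a\<in>A. m i a *s a + (m j a - m i a) *s a)"
    unfolding m using le by (intro sum.cong) (simp_all add: vector_sadd_rdistrib[symmetric])
  also have "\<dots> = (t + i *s s) + ?d" by (simp add: m sum.distrib)
  \<comment> \<open>Addition of natural vectors is cancellative, and by \<open>le\<close> no
    subtraction in \<open>?d\<close> is truncated.\<close>
  finally have "(j - i) *s s = ?d" by simp
  also have "?d \<in> T"
    using affine_semigroup_add_submonoid[OF aff] A(2)
    by (intro add_submonoid_sum add_submonoid_smult) auto
  finally show ?thesis using \<open>i < j\<close> by (intro exI[of _ "j - i"]) simp
qed

text \<open>If the coefficient of some \<open>b\<close> in \<open>x\<close> reaches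
  \<open>k b\<close>, then \<open>x\<close> is the element \<open>k b *s b\<close> of the ideal plus
  an element of \<open>S\<close>, hence in \<open>T\<close>. Outside \<open>T\<close> the
  coefficients therefore stay in a finite box.\<close>

lemma I_semigroup_cofinite:
  assumes S: "affine_semigroup S" and T: "I_semigroup S T"
  shows "finite (S - T)"
proof -
  note mS = affine_semigroup_add_submonoid[OF S]
  obtain A where A: "finite A" "A \<subseteq> S" "\<And>x. x \<in> S \<Longrightarrow> \<exists>m. x = (\<Sum>a\<in>A. m a *s a)"
    using affine_semigroup_generators[OF S] by blast
  \<comment> \<open>Dropping the generator 0 loses no combination and makes every
    \<open>k b *s b\<close> non-zero, so that it lies in the ideal.\<close>
  define B where "B = A - {0}"
  have B: "finite B" "B \<subseteq> S" "0 \<notin> B" using A by (auto simp: B_def)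
  have "\<forall>b\<in>B. \<exists>k>0. k *s b \<in> T" using I_semigroup_multiple[OF mS T] B(2) by blast
  then obtain k where k: "\<And>b. b \<in> B \<Longrightarrow> k b > 0 \<and> k b *s b \<in> T" by metis
  have "S - T \<subseteq> (\<lambda>m. \<Sum>b\<in>B. m b *s b) ` (\<Pi>\<^sub>E b\<in>B. {..<k b})"
  proof
    fix x assume x: "x \<in> S - T"
    then obtain m where "x = (\<Sum>a\<in>A. m a *s a)" using A(3) by blast
    also have "\<dots> = (\<Sum>b\<in>B. m b *s b)"
      unfolding B_def by (intro sum.mono_neutral_right) (use A(1) in auto)
    finally have xm: "x = (\<Sum>b\<in>B. m b *s b)" .
    have lt: "m b < k b" if b: "b \<in> B" for b
    proof (rule ccontr)
      assume "\<not> m b < k b"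
      then have "m b *s b = k b *s b + (m b - k b) *s b"
        by (simp add: vector_sadd_rdistrib[symmetric])
      then have "x = k b *s b + ((m b - k b) *s b + (\<Sum>c\<in>B - {b}. m c *s c))"
        unfolding xm using b B(1) by (simp add: sum.remove[of B b] add.assoc)
      moreover have "(m b - k b) *s b + (\<Sum>c\<in>B - {b}. m c *s c) \<in> S"
      proof -
        have "(m b - k b) *s b \<in> S" "(\<Sum>c\<in>B - {b}. m c *s c) \<in> S"
          using b B(2) mS by (auto intro!: add_submonoid_sum add_submonoid_smult)
        then show ?thesis using mS by (simp add: add_submonoid_def)
      qed
      moreover have "k b *s b \<noteq> 0"
      proof -
        have "b \<noteq> 0" using b B(3) by blast
        then show ?thesis using k[OF b] by (simp add: vec_eq_iff)
      qed
      ultimately have "x \<in> T" using I_semigroup_add[OF T, of "k b *s b"] k[OF b] by simp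
      with x show False by simp
    qed
    \<comment> \<open>Restriction makes the coefficient function extensional, as membership in the
      finite product requires.\<close>
    have "x = (\<Sum>b\<in>B. restrict m B b *s b)" unfolding xm by (intro sum.cong) auto
    moreover have "restrict m B \<in> (\<Pi>\<^sub>E b\<in>B. {..<k b})" using lt by auto
    ultimately show "x \<in> (\<lambda>m. \<Sum>b\<in>B. m b *s b) ` (\<Pi>\<^sub>E b\<in>B. {..<k b})" by blast
  qed
  moreover have "finite ((\<lambda>m. \<Sum>b\<in>B. m b *s b) ` (\<Pi>\<^sub>E b\<in>B. {..<k b}))"
    using B(1) by (intro finite_imageI finite_PiE) simp_all
  ultimately show ?thesis by (rule finite_subset)
qed

section \<open>Rational cones and the passage to \<open>C_semigroup\<close>\<close>

lemma rat_coneI: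
  fixes k :: nat
  assumes "\<And>i. i < k \<Longrightarrow> 0 \<le> c i" "\<And>i. i < k \<Longrightarrow> b i \<in> S"
  shows "(\<Sum>i<k. c i *s rat_vec (b i)) \<in> rat_cone S"
  unfolding rat_cone_def
  by (intro CollectI exI[of _ k] exI[of _ c] exI[of _ b] conjI refl) (simp add: assms)

lemma rat_coneE:
  assumes "x \<in> rat_cone S"
  obtains k :: nat and c b where "x = (\<Sum>i<k. c i *s rat_vec (b i))"
    "\<And>i. i < k \<Longrightarrow> 0 \<le> c i" "\<And>i. i < k \<Longrightarrow> b i \<in> S"
proof -
  from assms obtain k :: nat and c b
    where "x = (\<Sum>i<k. c i *s rat_vec (b i))" "\<forall>i<k. 0 \<le> c i \<and> b i \<in> S"
    unfolding rat_cone_def by (elim CollectE exE conjE)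
  then show thesis by (intro that) auto
qed

lemma rat_cone_mono:
  assumes "A \<subseteq> B"
  shows "rat_cone A \<subseteq> rat_cone B"
proof
  fix x assume "x \<in> rat_cone A"
  then obtain k :: nat and c b where "x = (\<Sum>i<k. c i *s rat_vec (b i))"
    "\<And>i. i < k \<Longrightarrow> 0 \<le> c i" "\<And>i. i < k \<Longrightarrow> b i \<in> A"
    using rat_coneE by blast
  then show "x \<in> rat_cone B" using assms by (auto intro: rat_coneI)
qed

text \<open>The cone of \<open>T\<close> lies in that of \<open>S\<close>, so each gap of
  \<open>T\<close> is a gap of \<open>S\<close> or an element of \<open>S - T\<close>.\<close>

lemma C_semigroup_I_semigroup:
  assumes S: "C_semigroup S" and T: "I_semigroup S T"
  shows "C_semigroup T"
proof -
  have aS: "affine_semigroup S" using S by (simp add: C_semigroup_def)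
  have "T \<subseteq> S" using I_semigroup_subset[OF T affine_semigroup_add_submonoid[OF aS]] .
  then have "int_cone T - T \<subseteq> (int_cone S - S) \<union> (S - T)"
    using rat_cone_mono unfolding int_cone_def by blast
  moreover have "finite ((int_cone S - S) \<union> (S - T))"
    using S I_semigroup_cofinite[OF aS T] by (simp add: C_semigroup_def)
  ultimately have "finite (int_cone T - T)" by (rule finite_subset)
  then show ?thesis using T by (simp add: C_semigroup_def I_semigroup_def)
qed

section \<open>Extremal rays\<close>

lemma rat_cone_0: "0 \<in> rat_cone S"
  using rat_coneI[of 0] by simp

lemma rat_cone_scale:
  assumes "x \<in> rat_cone S" "0 \<le> q"
  shows "q *s x \<in> rat_cone S"
proof -
  obtain k :: nat and c b where x: "x = (\<Sum>i<k. c i *s rat_vec (b i))"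
    "\<And>i. i < k \<Longrightarrow> 0 \<le> c i" "\<And>i. i < k \<Longrightarrow> b i \<in> S"
    using rat_coneE[OF assms(1)] by blast
  have "q *s x = (\<Sum>i<k. (q * c i) *s rat_vec (b i))"
    by (simp add: x(1) vec.scale_sum_right)
  also have "\<dots> \<in> rat_cone S" using x(2,3) assms(2) by (intro rat_coneI) auto
  finally show ?thesis .
qed

lemma rat_face_ofD:
  assumes "rat_face_of F K"
  shows "F \<subseteq> K" "rat_convex F"
    and "\<lbrakk>a \<in> K; b \<in> K; 0 < u; u < 1; (1 - u) *s a + u *s b \<in> F\<rbrakk> \<Longrightarrow> a \<in> F \<and> b \<in> F"
proof -
  note face = assms[unfolded rat_face_of_def]
  show "F \<subseteq> K" by (rule face[THEN conjunct1])
  show "rat_convex F" by (rule face[THEN conjunct2, THEN conjunct1])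
  show "a \<in> F \<and> b \<in> F"
    if "a \<in> K" "b \<in> K" "0 < u" "u < 1" "(1 - u) *s a + u *s b \<in> F"
    by (rule face[THEN conjunct2, THEN conjunct2, rule_format, of a b u]) (intro that conjI)+
qed

text \<open>For a factor above 1, \<open>x\<close> lies strictly between 0 and its multiple, so the
  face contains both. With 0 in the face, convexity handles factors up to 1.\<close>

lemma rat_face_scale:
  assumes F: "rat_face_of F (rat_cone S)" and x: "x \<in> F" and q: "0 \<le> q"
  shows "q *s x \<in> F"
proof -
  have up: "0 \<in> F \<and> r *s x \<in> F" if "r > 1" for r
  proof (rule rat_face_ofD(3)[OF F, of _ _ "1 / r"])
    show "r *s x \<in> rat_cone S" using rat_face_ofD(1)[OF F] x that by (intro rat_cone_scale) auto
    show "(1 - 1 / r) *s 0 + (1 / r) *s (r *s x) \<in> F" using x that by simp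
  qed (use that in \<open>auto simp: rat_cone_0\<close>)
  show ?thesis
  proof (cases "q > 1")
    case True
    then show ?thesis using up by blast
  next
    case False
    \<comment> \<open>The instance \<open>up[of 2]\<close> only serves to supply that 0 is in
      \<open>F\<close>.\<close>
    have "(1 - q) *s 0 + q *s x \<in> F"
      using rat_face_ofD(2)[OF F, unfolded rat_convex_def, rule_format, of 0 x q] up[of 2] x q False
      by simp
    then show ?thesis by simp
  qed
qed

text \<open>A non-zero point of the face is a non-negative combination of elements of
  \<open>S\<close>; the face property forces any non-zero summand, and hence its generator, into the
  face.\<close>

lemma rat_face_generator:
  assumes F: "rat_face_of F (rat_cone S)" and dim: "vec.dim F = 1"
  obtains s where "s \<in> S" "s \<noteq> 0" "rat_vec s \<in> F"
proof -
  have "\<not> F \<subseteq> {0}" using vec.dim_subset[of F "{0}"] dim by (auto simp: vec.dim_eq_0)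
  then obtain f where f: "f \<in> F" "f \<noteq> 0" by blast
  then have "f \<in> rat_cone S" using rat_face_ofD(1)[OF F] by blast
  then obtain k :: nat and c b where x: "f = (\<Sum>i<k. c i *s rat_vec (b i))"
    "\<And>i. i < k \<Longrightarrow> 0 \<le> c i" "\<And>i. i < k \<Longrightarrow> b i \<in> S"
    using rat_coneE by blast
  obtain j where j: "j < k" "c j *s rat_vec (b j) \<noteq> 0"
  proof -
    have "\<exists>j\<in>{..<k}. c j *s rat_vec (b j) \<noteq> 0"
    proof (rule ccontr)
      assume "\<not> ?thesis"
      then have "f = 0" unfolding x(1) by (intro sum.neutral) blast
      with f(2) show False by simp
    qed
    then show thesis using that by blast
  qed
  then have cj: "c j > 0" using x(2) by (auto simp: less_le)
  let ?u = "c j *s rat_vec (b j)"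
  \<comment> \<open>The remaining summands, with coefficient 0 at \<open>j\<close> so that the index
    set stays an initial segment and \<open>rat_coneI\<close> applies.\<close>
  let ?v = "\<Sum>i<k. (if i = j then 0 else c i) *s rat_vec (b i)"
  have "f = (\<Sum>i<k. (if i = j then c j else 0) *s rat_vec (b i) +
      (if i = j then 0 else c i) *s rat_vec (b i))"
    unfolding x(1) by (intro sum.cong) auto
  also have "\<dots> = (\<Sum>i<k. (if i = j then c j else 0) *s rat_vec (b i)) + ?v"
    by (rule sum.distrib)
  also have "(\<Sum>i<k. (if i = j then c j else 0) *s rat_vec (b i)) = (\<Sum>i<k. if i = j then ?u else 0)"
    by (intro sum.cong) auto
  also have "\<dots> = ?u" using j(1) by simp
  finally have fuv: "f = ?u + ?v" .
  have u: "?u \<in> rat_cone S"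
    using rat_coneI[of 1 "\<lambda>_. c j" "\<lambda>_. b j" S] x(2,3) j(1) by simp
  have v: "?v \<in> rat_cone S"
    using x(2,3) by (intro rat_coneI) auto
  \<comment> \<open>A sum of two cone points is the midpoint of their doubles, which brings it into
    the form used by the face property.\<close>
  have "(1 - 1 / 2) *s (2 *s ?u) + (1 / 2) *s (2 *s ?v) \<in> F"
    using f(1) fuv by simp
  moreover have "2 *s ?u \<in> rat_cone S" "2 *s ?v \<in> rat_cone S"
    by (rule rat_cone_scale[OF u] rat_cone_scale[OF v], simp)+
  moreover have "(0::rat) < 1 / 2" "(1 / 2 :: rat) < 1" by simp_all
  ultimately have "2 *s ?u \<in> F"
    using rat_face_ofD(3)[OF F, of "2 *s ?u" "2 *s ?v" "1 / 2"] by blast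
  \<comment> \<open>This factor undoes both the doubling and the coefficient \<open>c j\<close>,
    leaving the generator itself.\<close>
  then have "(1 / (2 * c j)) *s (2 *s ?u) \<in> F"
    by (rule rat_face_scale[OF F]) (use cj in simp)
  moreover have "1 / (2 * c j) * (2 * c j) = 1" using cj by simp
  ultimately have "rat_vec (b j) \<in> F"
    by (simp only: vector_smult_assoc vector_smult_lid mult.assoc)
  moreover have "b j \<noteq> 0"
  proof
    assume "b j = 0"
    then have "rat_vec (b j) = 0" by (simp add: rat_vec_def vec_eq_iff)
    with j(2) show False by simp
  qed
  ultimately show thesis using that[OF x(3)[OF j(1)]] by simp
qed

lemma rat_vec_smult: "rat_vec (n *s x) = of_nat n *s rat_vec x"
  by (simp add: rat_vec_def vec_eq_iff)

lemma extremal_ray_smult: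
  assumes "\<tau> \<in> extremal_rays S" "x \<in> \<tau>"
  shows "n *s x \<in> \<tau>"
  using assms by (auto simp: extremal_rays_def rat_vec_smult intro!: rat_face_scale)

text \<open>A non-zero element of \<open>S\<close> on the ray has a positive multiple in
  \<open>T\<close>, and scaling stays on the ray.\<close>

lemma extremal_ray_meets_I_semigroup:
  assumes S: "add_submonoid S" and T: "I_semigroup S T" and \<tau>: "\<tau> \<in> extremal_rays S"
  obtains x where "x \<in> T - {0}" "x \<in> \<tau>"
proof -
  obtain s where s: "s \<in> S" "s \<noteq> 0" "s \<in> \<tau>"
    using \<tau> rat_face_generator unfolding extremal_rays_def by blast
  obtain k where k: "k > 0" "k *s s \<in> T" using I_semigroup_multiple[OF S T s(1)] by blast
  have "k *s s \<noteq> 0" using k(1) s(2) by (simp add: vec_eq_iff)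
  then show thesis using that k(2) extremal_ray_smult[OF \<tau> s(3)] by blast
qed

theorem corollary7:
  fixes S T :: "(nat ^ 'p) set"
  assumes "C_semigroup S"
    and "I_semigroup S T"
  shows "C_semigroup T \<longleftrightarrow>
    (\<exists>Y. Y \<subset> T - {0} \<and> (\<forall>\<tau>\<in>extremal_rays S. Y \<inter> \<tau> \<noteq> {}))"
proof -
  have S: "add_submonoid S"
    using assms(1) by (simp add: C_semigroup_def affine_semigroup_add_submonoid)
  have T: "add_submonoid T"
    using assms(2) by (simp add: I_semigroup_def affine_semigroup_add_submonoid)
  obtain z where z: "z \<in> T - {0}"
    using assms(2) by (auto simp: I_semigroup_def semigroup_ideal_def)
  \<comment> \<open>Removing one point makes the inclusion strict and loses no ray, since \<open>x\<close> and \<open>2 x\<close> share theirs.\<close>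
  define Y where "Y = T - {0} - {z}"
  have "Y \<inter> \<tau> \<noteq> {}" if \<tau>: "\<tau> \<in> extremal_rays S" for \<tau>
  proof -
    obtain x where x: "x \<in> T - {0}" "x \<in> \<tau>"
      using extremal_ray_meets_I_semigroup[OF S assms(2) \<tau>] .
    have "2 *s x \<in> T" "2 *s x \<in> \<tau>"
      using x add_submonoid_smult[OF T] extremal_ray_smult[OF \<tau>] by auto
    moreover have "2 *s x \<noteq> 0" "2 *s x \<noteq> x" using x(1) by (auto simp: vec_eq_iff)
    ultimately show ?thesis using x by (cases "x = z") (auto simp: Y_def)
  qed
  moreover have "Y \<subset> T - {0}" using z by (auto simp: Y_def)
  ultimately have "\<exists>Y. Y \<subset> T - {0} \<and> (\<forall>\<tau>\<in>extremal_rays S. Y \<inter> \<tau> \<noteq> {})" by blast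
  then show ?thesis using C_semigroup_I_semigroup[OF assms] by blast
qed

end
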